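(* Let $C_0,C_1,C_2,\ldots$ be independent and identically distributed complex-valued random variables with absolutely continuous distribution and $\mathbb{E}[|C_0|^t]<\infty$ for some $t>0$, and let $P_n(z)=\sum_{k=0}^nC_kz^k$, $n\ge1$. Let $E\subset\mathbb{C}$ be a compact set such that $E\cap\mathbb{T}=\emptyset$, and set $d:=\mathrm{dist}(E,\mathbb{T})$. Then the expected number of zeros of $P_n$ in $E$ satisfies $$\mathbb{E}\left[n\,\tau_n(E)\right]\le\frac{d+1}{d}\left(\frac{t+2}{t}\log(n+1)+\frac2t\log\mathbb{E}[|C_0|^t]-2\,\mathbb{E}[\log|C_0|]\right).$$
   Context: $\mathbb{T}=\{z\in\mathbb{C}:|z|=1\}$ and $\mathrm{dist}$ is Euclidean distance. "Absolutely continuous" means having a density with respect to area measure on $\mathbb{C}$; in particular $C_0C_n\neq0$ almost surely. $\tau_n=\frac1n\sum_{k=1}^n\delta_{Z_k}$ is the normalized counting measure of the $n$ complex zeros $Z_1,\dots,Z_n$ of $P_n$ (with multiplicity), so $n\tau_n(E)$ is the number of zeros in $E$. The expectation $\mathbb{E}[\log|C_0|]$ takes values in $[-\infty,\infty)$; if it equals $-\infty$, the right-hand side is read as $+\infty$. *)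

theory Defs
  imports
    "HOL-Probability.Probability"
    "HOL-Computational_Algebra.Computational_Algebra"
begin

definition random_poly :: "(nat \<Rightarrow> 'a \<Rightarrow> complex) \<Rightarrow> nat \<Rightarrow> 'a \<Rightarrow> complex poly" where
  "random_poly C n \<omega> = (\<Sum>k\<le>n. monom (C k \<omega>) k)"

lemma poly_random_poly: "poly (random_poly C n \<omega>) z = (\<Sum>k\<le>n. C k \<omega> * z ^ k)"
  by (simp add: random_poly_def poly_sum poly_monom)

(* The measure 1/n * (sum of the Dirac masses at the zeros, repeated according to multiplicity).
   The polynomials of interest have degree n almost surely; for the zero polynomial, proots is
   empty and the measure is 0. For compact E the mass of E is a Borel function of the coefficients
   (continuity of the roots, on each stratum of fixed degree), so its nonnegative integral is the
   expectation. *)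
definition zero_counting_measure :: "nat \<Rightarrow> complex poly \<Rightarrow> complex measure" where
  "zero_counting_measure n p = point_measure UNIV (\<lambda>z. ennreal (real (count (proots p) z) / real n))"

lemma emeasure_zero_counting_measure:
  assumes "n \<ge> 1"
  shows "of_nat n * emeasure (zero_counting_measure n p) E = of_nat (size (filter_mset (\<lambda>z. z \<in> E) (proots p)))"
proof -
  let ?A = "set_mset (proots p)"
  have "emeasure (zero_counting_measure n p) E
      = (\<integral>\<^sup>+z. ennreal (real (count (proots p) z) / real n) * indicator E z \<partial>count_space UNIV)"
    unfolding zero_counting_measure_def point_measure_def by (subst emeasure_density) auto
  also have "\<dots> = (\<integral>\<^sup>+z. ennreal (real (count (filter_mset (\<lambda>z. z \<in> E) (proots p)) z) / real n) \<partial>count_space UNIV)"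
    by (intro nn_integral_cong) (auto split: split_indicator)
  also have "\<dots> = (\<Sum>z\<in>?A. ennreal (real (count (filter_mset (\<lambda>z. z \<in> E) (proots p)) z) / real n))"
    by (rule nn_integral_count_space') (auto simp: not_in_iff)
  also have "\<dots> = ennreal (\<Sum>z\<in>?A. real (count (filter_mset (\<lambda>z. z \<in> E) (proots p)) z) / real n)"
    by (rule sum_ennreal) auto
  also have "(\<Sum>z\<in>?A. real (count (filter_mset (\<lambda>z. z \<in> E) (proots p)) z) / real n)
      = real (size (filter_mset (\<lambda>z. z \<in> E) (proots p))) / real n"
    unfolding size_multiset_overloaded_eq sum_divide_distrib[symmetric] of_nat_sum
    by (intro arg_cong[where f = "\<lambda>x. x / real n"] sum.mono_neutral_right) (auto simp: not_in_iff)
  finally show ?thesis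
    using assms by (simp flip: ennreal_of_nat_eq_real_of_nat ennreal_mult)
       (simp add: ennreal_of_nat_eq_real_of_nat flip: ennreal_mult)
qed

(* Expectation with values in the extended reals, as the difference of the integrals of the
   positive and the negative part; meaningful as soon as one of the two is finite. For X = ln |C|, the totalised value
   ln 0 = 0 is harmless if C is almost surely nonzero, as when C has a density. *)
definition ext_expectation :: "'a measure \<Rightarrow> ('a \<Rightarrow> real) \<Rightarrow> ereal" where
  "ext_expectation M X =
     enn2ereal (\<integral>\<^sup>+\<omega>. ennreal (X \<omega>) \<partial>M) - enn2ereal (\<integral>\<^sup>+\<omega>. ennreal (- X \<omega>) \<partial>M)"

lemma ext_expectation_integrable:
  assumes "integrable M X"
  shows "ext_expectation M X = ereal (\<integral>\<omega>. X \<omega> \<partial>M)"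
proof -
  have "(\<integral>\<^sup>+\<omega>. ennreal (X \<omega>) \<partial>M) \<noteq> \<infinity>" "(\<integral>\<^sup>+\<omega>. ennreal (- X \<omega>) \<partial>M) \<noteq> \<infinity>"
    using assms by (auto simp: real_integrable_def)
  then show ?thesis
    unfolding ext_expectation_def real_lebesgue_integral_def[OF assms]
    by (cases "\<integral>\<^sup>+\<omega>. ennreal (X \<omega>) \<partial>M"; cases "\<integral>\<^sup>+\<omega>. ennreal (- X \<omega>) \<partial>M")
       (auto simp: enn2ereal_ennreal)
qed

end

theory Submission
  imports Defs
begin

text \<open>
  The bound rests on a deterministic estimate. If \<open>p = \<Sum>k\<le>n. c\<^sub>k z\<^sup>k\<close> has \<open>c\<^sub>0 \<noteq> 0 \<noteq> c\<^sub>n\<close>, then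
  \<open>\<bar>ln \<bar>z\<bar>\<bar> = 2 max 0 (ln \<bar>z\<bar>) - ln \<bar>z\<bar>\<close>, summed over the zeros \<open>z\<close> of \<open>p\<close>, gives
  \<open>2 ln (M p) - ln \<bar>c\<^sub>0\<bar> - ln \<bar>c\<^sub>n\<bar>\<close>, where \<open>M p = \<bar>c\<^sub>n\<bar> \<Prod> max 1 \<bar>z\<bar>\<close> is the Mahler measure of \<open>p\<close>
  (this is Jensen's formula, once for \<open>p\<close> and once for its reciprocal polynomial).
  Landau's inequality \<open>(M p)\<^sup>2 \<le> \<Sum>k\<le>n. \<bar>c\<^sub>k\<bar>\<^sup>2\<close> (lemma \<open>Landau_inequality\<close>) has a purely algebraic
  proof: reflecting a zero in the unit circle does not change the square sum of the coefficients,
  and after all zeros outside the disc have been reflected the leading coefficient is \<open>M p\<close> up to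
  a unimodular factor. A zero at distance at least \<open>d\<close> from the circle contributes at least
  \<open>d / (d + 1)\<close> to the sum of the \<open>\<bar>ln \<bar>z\<bar>\<bar>\<close>, which bounds the number of zeros in \<open>E\<close>
  (lemma \<open>count_roots_le\<close>).

  For random coefficients it remains to bound the expectation of \<open>ln (\<Sum>k\<le>n. \<bar>c\<^sub>k\<bar>\<^sup>2)\<close>. Each
  \<open>\<bar>c\<^sub>k\<bar>\<^sup>2\<close> is at most \<open>Y powr (2 / t)\<close> with \<open>Y = \<Sum>k\<le>n. \<bar>c\<^sub>k\<bar> powr t\<close>, and Jensen's inequality for the
  logarithm reduces matters to the expectation of \<open>Y\<close>, which is \<open>n + 1\<close> times a single moment.
  The tangent line of \<open>ln\<close> at that expectation makes this last step pointwise, so that one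
  integrable random variable dominates the number of zeros.
\<close>

section \<open>Landau's inequality for the Mahler measure\<close>

definition coeff_sq_sum :: "complex poly \<Rightarrow> real" where
  "coeff_sq_sum p = (\<Sum>k\<le>degree p. (cmod (coeff p k))\<^sup>2)"

lemma coeff_sq_sum_eq:
  assumes "degree p \<le> N"
  shows "coeff_sq_sum p = (\<Sum>k\<le>N. (cmod (coeff p k))\<^sup>2)"
  unfolding coeff_sq_sum_def
  by (rule sum.mono_neutral_left) (use assms in \<open>auto simp: coeff_eq_0\<close>)

lemma lead_coeff_sq_le_coeff_sq_sum: "(cmod (lead_coeff p))\<^sup>2 \<le> coeff_sq_sum p"
  unfolding coeff_sq_sum_def
  by (rule member_le_sum[where f = "\<lambda>k. (cmod (coeff p k))\<^sup>2"]) auto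

lemma cmod_diff_sq: "(cmod (x - y))\<^sup>2 = (cmod x)\<^sup>2 + (cmod y)\<^sup>2 - 2 * Re (x * cnj y)"
  unfolding cmod_power2 by (simp add: power2_eq_square algebra_simps)

text \<open>
  On the unit circle \<open>z - a\<close> and \<open>1 - cnj a * z\<close> have the same modulus, so by Parseval the two
  products below have the same square sum. Comparing coefficients directly, the mixed terms agree
  up to conjugation and the square terms are shifts of each other.
\<close>
lemma coeff_sq_sum_reflect_root:
  "coeff_sq_sum (p * [:-a, 1:]) = coeff_sq_sum (p * [:1, -cnj a:])"
proof -
  define N where "N = degree p"
  define c where "c = (\<lambda>k. (cmod (coeff p k))\<^sup>2)"
  define m where "m = (\<lambda>k. Re (coeff p k * cnj (a * coeff p (Suc k))))"
  have degs: "degree (p * [:-a, 1:]) \<le> Suc N" "degree (p * [:1, -cnj a:]) \<le> Suc N"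
    unfolding N_def by (rule order.trans[OF degree_mult_le], simp)+
  have top: "coeff p (Suc N) = 0"
    by (simp add: N_def coeff_eq_0)
  have shift: "(\<Sum>k\<le>N. c (Suc k)) = (\<Sum>k\<le>N. c k) - c 0"
  proof -
    have "(\<Sum>k\<le>Suc N. c k) = (\<Sum>k\<le>N. c k)"
      by (simp add: c_def top)
    then show ?thesis
      by (subst (asm) sum.atMost_Suc_shift) simp
  qed
  have "coeff_sq_sum (p * [:-a, 1:]) =
      (cmod a)\<^sup>2 * c 0 + (\<Sum>k\<le>N. c k + (cmod a)\<^sup>2 * c (Suc k) - 2 * m k)"
  proof -
    have "(cmod (coeff (p * [:-a, 1:]) (Suc k)))\<^sup>2 = c k + (cmod a)\<^sup>2 * c (Suc k) - 2 * m k" for k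
      using cmod_diff_sq[of "coeff p k" "a * coeff p (Suc k)"]
      by (simp add: c_def m_def norm_mult power_mult_distrib)
    moreover have "(cmod (coeff (p * [:-a, 1:]) 0))\<^sup>2 = (cmod a)\<^sup>2 * c 0"
      by (simp add: c_def norm_mult power_mult_distrib)
    ultimately show ?thesis
      by (simp only: coeff_sq_sum_eq[OF degs(1)] sum.atMost_Suc_shift)
  qed
  moreover have "coeff_sq_sum (p * [:1, -cnj a:]) =
      c 0 + (\<Sum>k\<le>N. c (Suc k) + (cmod a)\<^sup>2 * c k - 2 * m k)"
  proof -
    have "(cmod (coeff (p * [:1, -cnj a:]) (Suc k)))\<^sup>2 = c (Suc k) + (cmod a)\<^sup>2 * c k - 2 * m k" for k
      using cmod_diff_sq[of "coeff p (Suc k)" "cnj a * coeff p k"]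
      by (simp add: c_def m_def norm_mult power_mult_distrib algebra_simps)
    moreover have "(cmod (coeff (p * [:1, -cnj a:]) 0))\<^sup>2 = c 0"
      by (simp add: c_def)
    ultimately show ?thesis
      by (simp only: coeff_sq_sum_eq[OF degs(2)] sum.atMost_Suc_shift)
  qed
  ultimately show ?thesis
    unfolding sum.distrib sum_subtractf sum_distrib_left[symmetric] shift
    by (simp only: right_diff_distrib)
qed

text \<open>
  The zeros are processed one at a time. Those in the closed disc are absorbed into the factor
  \<open>q\<close> as they are, the others after reflection, which multiplies the leading coefficient of \<open>q\<close>
  by a number of modulus \<open>cmod a\<close>; this is why \<open>q\<close> is arbitrary.
\<close>
lemma Landau_inequality_factored:
  fixes A :: "complex multiset"
  shows "(cmod (lead_coeff q) * (\<Prod>a\<in>#A. max 1 (cmod a)))\<^sup>2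
    \<le> coeff_sq_sum (q * (\<Prod>a\<in>#A. [:-a, 1:]))"
proof (induction A arbitrary: q)
  case empty
  show ?case
    using lead_coeff_sq_le_coeff_sq_sum[of q] by simp
next
  case (add a A)
  let ?R = "\<Prod>a\<in>#A. [:-a, 1:]"
  show ?case
  proof (cases "cmod a \<le> 1")
    case True
    have lead: "lead_coeff (q * [:-a, 1:]) = lead_coeff q"
      by (simp only: lead_coeff_mult) simp
    show ?thesis
      using add.IH[of "q * [:-a, 1:]"] True unfolding lead
      by (simp only: image_mset_add_mset prod_mset.add_mset max_absorb1 mult_1_left mult.assoc)
  next
    case False
    then have "lead_coeff [:1, -cnj a:] = - cnj a"
      by auto
    then have lead: "cmod (lead_coeff (q * [:1, -cnj a:])) = cmod (lead_coeff q) * cmod a"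
      by (simp only: lead_coeff_mult norm_mult norm_minus_cancel complex_mod_cnj)
    have "coeff_sq_sum (q * (\<Prod>a\<in>#add_mset a A. [:-a, 1:])) = coeff_sq_sum ((q * ?R) * [:-a, 1:])"
      by (simp only: image_mset_add_mset prod_mset.add_mset mult_ac)
    also have "\<dots> = coeff_sq_sum ((q * ?R) * [:1, -cnj a:])"
      by (rule coeff_sq_sum_reflect_root)
    also have "\<dots> = coeff_sq_sum ((q * [:1, -cnj a:]) * ?R)"
      by (simp only: mult_ac)
    also have "\<dots> \<ge> (cmod (lead_coeff q) * cmod a * (\<Prod>a\<in>#A. max 1 (cmod a)))\<^sup>2"
      using add.IH[of "q * [:1, -cnj a:]"] unfolding lead .
    finally show ?thesis
      using False by (simp add: mult.assoc max_def)
  qed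
qed

lemma Landau_inequality:
  "(cmod (lead_coeff p) * (\<Prod>z\<in>#proots p. max 1 (cmod z)))\<^sup>2 \<le> coeff_sq_sum p"
  using Landau_inequality_factored[of "[:lead_coeff p:]" "proots p"]
  by (simp add: complex_poly_decompose_multiset)

section \<open>Zeros away from the unit circle\<close>

lemma ln_prod_mset:
  fixes f :: "'a \<Rightarrow> real"
  assumes "\<And>x. x \<in># A \<Longrightarrow> f x > 0"
  shows "(\<Prod>x\<in>#A. f x) > 0 \<and> ln (\<Prod>x\<in>#A. f x) = (\<Sum>x\<in>#A. ln (f x))"
  using assms by (induction A) (auto simp: ln_mult_pos)

text \<open>
  The zeros outside the disc are controlled by the Mahler measure, and their product by the two
  extreme coefficients; the identity \<open>\<bar>x\<bar> = 2 max 0 x - x\<close> combines both.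
\<close>
lemma sum_abs_ln_roots_le:
  fixes p :: "complex poly"
  assumes "coeff p 0 \<noteq> 0"
  shows "(\<Sum>z\<in>#proots p. \<bar>ln (cmod z)\<bar>)
    \<le> ln (coeff_sq_sum p) - ln (cmod (coeff p 0)) - ln (cmod (lead_coeff p))"
proof -
  let ?c = "cmod (lead_coeff p)"
  have p0: "p \<noteq> 0"
    using assms by auto
  then have c: "?c > 0"
    by simp
  have nz: "cmod z > 0" if "z \<in># proots p" for z
    using that assms p0 by (auto simp: poly_0_coeff_0)
  have const: "coeff p 0 = lead_coeff p * (\<Prod>z\<in>#proots p. - z)"
  proof -
    have "poly (\<Prod>z\<in>#A. [:-z, 1:]) 0 = (\<Prod>z\<in>#A. - z)" for A :: "complex multiset"
      by (induction A) auto
    then show ?thesis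
      using arg_cong[OF complex_poly_decompose_multiset[of p], of "\<lambda>q. poly q 0"]
      by (simp add: poly_0_coeff_0)
  qed
  have norm_prod: "cmod (\<Prod>z\<in>#A. - z) = (\<Prod>z\<in>#A. cmod z)" for A :: "complex multiset"
    by (induction A) (auto simp: norm_mult)
  have ln_const: "ln (cmod (coeff p 0)) = ln ?c + (\<Sum>z\<in>#proots p. ln (cmod z))"
    using ln_prod_mset[of "proots p" cmod] nz c
    by (subst const) (simp only: norm_mult norm_prod ln_mult_pos)
  have mahler: "2 * ln ?c + 2 * (\<Sum>z\<in>#proots p. ln (max 1 (cmod z))) \<le> ln (coeff_sq_sum p)"
  proof -
    let ?M = "?c * (\<Prod>z\<in>#proots p. max 1 (cmod z))"
    have *: "(\<Prod>z\<in>#proots p. max 1 (cmod z)) > 0"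
      "ln (\<Prod>z\<in>#proots p. max 1 (cmod z)) = (\<Sum>z\<in>#proots p. ln (max 1 (cmod z)))"
      using ln_prod_mset[of "proots p" "\<lambda>z. max 1 (cmod z)"] by (auto simp: less_max_iff_disj)
    have "ln (?M\<^sup>2) \<le> ln (coeff_sq_sum p)"
      by (rule ln_mono) (use * c Landau_inequality[of p] in \<open>auto\<close>)
    moreover have "ln (?M\<^sup>2) = 2 * (ln ?c + (\<Sum>z\<in>#proots p. ln (max 1 (cmod z))))"
      using * c by (simp add: ln_realpow ln_mult_pos)
    ultimately show ?thesis
      by simp
  qed
  have split_sum: "(\<Sum>z\<in>#A. 2 * f z - g z) = 2 * (\<Sum>z\<in>#A. f z) - (\<Sum>z\<in>#A. g z)"
    for A :: "complex multiset" and f g :: "complex \<Rightarrow> real"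
    by (induction A) auto
  have "(\<Sum>z\<in>#proots p. \<bar>ln (cmod z)\<bar>)
      = (\<Sum>z\<in>#proots p. 2 * ln (max 1 (cmod z)) - ln (cmod z))"
    by (intro arg_cong[where f = sum_mset] image_mset_cong)
       (use nz in \<open>force simp: max_def abs_if\<close>)
  also have "\<dots> = 2 * (\<Sum>z\<in>#proots p. ln (max 1 (cmod z))) - (\<Sum>z\<in>#proots p. ln (cmod z))"
    by (rule split_sum)
  finally show ?thesis
    using ln_const mahler by linarith
qed

lemma abs_ln_cmod_ge:
  fixes z :: complex
  assumes "z \<noteq> 0" "d \<ge> 0" "d \<le> \<bar>cmod z - 1\<bar>"
  shows "d / (d + 1) \<le> \<bar>ln (cmod z)\<bar>"
proof (cases "cmod z \<ge> 1")
  case True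
  then have "d / (d + 1) = 1 - 1 / (1 + d)"
    using assms by (simp add: field_simps)
  also have "\<dots> \<le> 1 - 1 / cmod z"
    using assms True by (intro diff_left_mono divide_left_mono mult_pos_pos) auto
  also have "\<dots> \<le> ln (cmod z)"
    using ln_le_minus_one[of "1 / cmod z"] assms by (simp add: ln_div)
  finally show ?thesis
    by simp
next
  case False
  have "d / (d + 1) \<le> d"
    using assms by (simp add: field_simps)
  then show ?thesis
    using ln_le_minus_one[of "cmod z"] assms False by simp
qed

lemma setdist_unit_sphere_le:
  fixes z :: complex
  assumes "z \<in> E" "z \<noteq> 0"
  shows "setdist E (sphere 0 1) \<le> \<bar>cmod z - 1\<bar>"
proof -
  have "setdist E (sphere 0 1) \<le> dist z (sgn z)"
    by (rule setdist_le_dist) (use assms in \<open>auto simp: norm_sgn\<close>)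
  also have "dist z (sgn z) = \<bar>cmod z - 1\<bar>"
  proof -
    have "z - sgn z = (cmod z - 1) *\<^sub>R sgn z"
      using assms by (simp add: sgn_div_norm scaleR_left_diff_distrib left_diff_distrib)
    then show ?thesis
      using assms by (simp add: dist_norm norm_sgn)
  qed
  finally show ?thesis .
qed

lemma count_roots_le:
  fixes p :: "complex poly" and E :: "complex set"
  assumes "coeff p 0 \<noteq> 0" and d: "d = setdist E (sphere 0 1)" "d > 0"
  shows "real (size (filter_mset (\<lambda>z. z \<in> E) (proots p)))
    \<le> (d + 1) / d * (ln (coeff_sq_sum p) - ln (cmod (coeff p 0)) - ln (cmod (lead_coeff p)))"
proof -
  have nz: "z \<noteq> 0" if "z \<in># proots p" for z
    using that assms by (cases "p = 0") (auto simp: poly_0_coeff_0)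
  have "real (size (filter_mset (\<lambda>z. z \<in> E) A)) * (d / (d + 1)) \<le> (\<Sum>z\<in>#A. \<bar>ln (cmod z)\<bar>)"
    if "\<And>z. z \<in># A \<Longrightarrow> z \<noteq> 0" for A :: "complex multiset"
    using that
  proof (induction A)
    case empty
    show ?case by simp
  next
    case (add z A)
    have "d / (d + 1) \<le> \<bar>ln (cmod z)\<bar>" if "z \<in> E"
      using add.prems[of z] d that setdist_unit_sphere_le[of z E] by (intro abs_ln_cmod_ge) auto
    moreover have "real (size (filter_mset (\<lambda>z. z \<in> E) A)) * (d / (d + 1)) \<le> (\<Sum>z\<in>#A. \<bar>ln (cmod z)\<bar>)"
      using add by auto
    ultimately show ?case
      by (cases "z \<in> E") (auto simp: algebra_simps)
  qed
  from this[of "proots p", OF nz] sum_abs_ln_roots_le[OF assms(1)]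
  have "real (size (filter_mset (\<lambda>z. z \<in> E) (proots p))) * (d / (d + 1))
      \<le> ln (coeff_sq_sum p) - ln (cmod (coeff p 0)) - ln (cmod (lead_coeff p))"
    by linarith
  then show ?thesis
    using d(2) by (simp add: field_simps)
qed

section \<open>Moments and logarithmic moments of the coefficients\<close>

lemma coeff_random_poly: "coeff (random_poly C n \<omega>) k = (if k \<le> n then C k \<omega> else 0)"
  by (auto simp: random_poly_def coeff_sum coeff_monom)

lemma degree_random_poly: "C n \<omega> \<noteq> 0 \<Longrightarrow> degree (random_poly C n \<omega>) = n"
  by (intro antisym degree_le le_degree) (auto simp: coeff_random_poly)

text \<open>
  Every \<open>\<bar>c\<^sub>k\<bar>\<^sup>2\<close> is at most \<open>Y powr (2 / t)\<close>, where \<open>Y\<close> is the sum of the \<open>\<bar>c\<^sub>k\<bar> powr t\<close>; then \<open>ln Y\<close> is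
  bounded by its tangent at an arbitrary point \<open>m\<close>.
\<close>
lemma ln_sum_squares_le:
  fixes c :: "nat \<Rightarrow> complex"
  assumes "c 0 \<noteq> 0" "t > 0" "m > 0"
  shows "ln (\<Sum>k\<le>n. (cmod (c k))\<^sup>2)
    \<le> ln (real n + 1) + 2 / t * ((\<Sum>k\<le>n. cmod (c k) powr t) / m - 1 + ln m)"
proof -
  define Y where "Y = (\<Sum>k\<le>n. cmod (c k) powr t)"
  have Y: "Y > 0"
    unfolding Y_def by (rule sum_pos2[of _ 0]) (use assms in auto)
  have "(cmod (c k))\<^sup>2 \<le> Y powr (2 / t)" if "k \<le> n" for k
  proof -
    have "(cmod (c k))\<^sup>2 = (cmod (c k) powr t) powr (2 / t)"
      using assms by (simp add: powr_powr)
    also have "\<dots> \<le> Y powr (2 / t)"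
      unfolding Y_def
      by (intro powr_mono2 member_le_sum[where f = "\<lambda>k. cmod (c k) powr t"])
         (use assms that in auto)
    finally show ?thesis .
  qed
  then have "(\<Sum>k\<le>n. (cmod (c k))\<^sup>2) \<le> (\<Sum>k\<le>n. Y powr (2 / t))"
    by (intro sum_mono) auto
  also have "\<dots> = (real n + 1) * Y powr (2 / t)"
    by simp
  finally have "ln (\<Sum>k\<le>n. (cmod (c k))\<^sup>2) \<le> ln ((real n + 1) * Y powr (2 / t))"
    by (intro ln_mono sum_pos2[of _ 0]) (use assms in auto)
  also have "\<dots> = ln (real n + 1) + 2 / t * ln Y"
    using Y by (simp add: ln_mult_pos ln_powr)
  also have "ln Y \<le> Y / m - 1 + ln m"
    using ln_le_minus_one[of "Y / m"] Y assms by (simp add: ln_div)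
  finally show ?thesis
    using assms by (simp add: Y_def divide_right_mono)
qed

text \<open>
  Since \<open>ln x \<le> x powr t / t\<close>, the moment of order \<open>t\<close> bounds the integral of the positive part of
  the logarithm, so only the negative part can fail to be integrable.
\<close>
lemma integrable_ln_cmod_or_ext_expectation_eq_MInf:
  fixes X :: "'a \<Rightarrow> complex"
  assumes [measurable]: "X \<in> borel_measurable M"
    and "t > 0" "integrable M (\<lambda>\<omega>. cmod (X \<omega>) powr t)"
  shows "integrable M (\<lambda>\<omega>. ln (cmod (X \<omega>))) \<or> ext_expectation M (\<lambda>\<omega>. ln (cmod (X \<omega>))) = -\<infinity>"
proof -
  have "ln x \<le> x powr t / t" if "x \<ge> 0" for x
  proof (cases "x = 0")
    case False
    then have "t * ln x \<le> x powr t - 1"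
      using ln_le_minus_one[of "x powr t"] that by (simp add: ln_powr)
    then show ?thesis
      using assms(2) by (simp add: field_simps)
  qed (use assms(2) in auto)
  then have "(\<integral>\<^sup>+\<omega>. ennreal (ln (cmod (X \<omega>))) \<partial>M) \<le> (\<integral>\<^sup>+\<omega>. ennreal (cmod (X \<omega>) powr t / t) \<partial>M)"
    by (intro nn_integral_mono ennreal_leI) auto
  also have "\<dots> < \<infinity>"
    using assms(2) integrable_divide_zero[of t M] assms(3)
    by (subst nn_integral_eq_integral) auto
  finally have fin: "(\<integral>\<^sup>+\<omega>. ennreal (ln (cmod (X \<omega>))) \<partial>M) < \<infinity>" .
  show ?thesis
  proof (cases "(\<integral>\<^sup>+\<omega>. ennreal (- ln (cmod (X \<omega>))) \<partial>M) = \<infinity>")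
    case True
    then show ?thesis
      using fin unfolding ext_expectation_def
      by (cases "\<integral>\<^sup>+\<omega>. ennreal (ln (cmod (X \<omega>))) \<partial>M") (auto simp: enn2ereal_ennreal)
  next
    case False
    then show ?thesis
      using fin by (auto simp: real_integrable_def)
  qed
qed

lemma AE_nonzero_of_distributed_lborel:
  fixes X X' :: "'a \<Rightarrow> 'b :: euclidean_space"
  assumes "distributed M lborel X f" and "X' \<in> borel_measurable M"
    and "distr M borel X' = distr M borel X"
  shows "AE \<omega> in M. X' \<omega> \<noteq> 0"
proof -
  have "AE x in density lborel f. x \<noteq> 0"
    using distributed_borel_measurable[OF assms(1)] AE_lborel_singleton[of 0]
    by (subst AE_density) (auto elim: AE_mp)
  also have "density lborel f = distr M lborel X"
    using assms(1) by (simp add: distributed_def)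
  also have "\<dots> = distr M borel X'"
    unfolding assms(3) by (rule distr_cong) auto
  finally show ?thesis
    using assms(2) by (subst (asm) AE_distr_iff) auto
qed

lemma integral_comp_eq_of_distr_eq:
  fixes f :: "'b \<Rightarrow> real"
  assumes "X \<in> measurable M N" "X' \<in> measurable M N" "distr M N X' = distr M N X"
    and "f \<in> borel_measurable N"
  shows "integrable M (\<lambda>\<omega>. f (X' \<omega>)) \<longleftrightarrow> integrable M (\<lambda>\<omega>. f (X \<omega>))"
    and "(\<integral>\<omega>. f (X' \<omega>) \<partial>M) = (\<integral>\<omega>. f (X \<omega>) \<partial>M)"
  using integrable_distr_eq[of X M N f] integrable_distr_eq[of X' M N f]
    integral_distr[of X M N f] integral_distr[of X' M N f] assms by auto

section \<open>The expected number of zeros\<close>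

theorem proposition3p4:
  fixes M :: "'a measure"
    and C :: "nat \<Rightarrow> 'a \<Rightarrow> complex"
    and E :: "complex set"
    and t d :: real
    and n :: nat
  assumes "prob_space M"
    and "prob_space.indep_vars M (\<lambda>_. borel) C UNIV"
    and "\<And>k. distr M borel (C k) = distr M borel (C 0)"
    and "\<exists>f. distributed M lborel (C 0) f"
    and "t > 0"
    and "integrable M (\<lambda>\<omega>. cmod (C 0 \<omega>) powr t)"
    and "n \<ge> 1"
    and "compact E"
    and "E \<inter> sphere 0 1 = {}"
    and "d = setdist E (sphere 0 1)"
  shows "enn2ereal (\<integral>\<^sup>+\<omega>. of_nat n * emeasure (zero_counting_measure n (random_poly C n \<omega>)) E \<partial>M)
    \<le> ereal ((d + 1) / d) *
      (ereal ((t + 2) / t * ln (real n + 1)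
          + 2 / t * ln (prob_space.expectation M (\<lambda>\<omega>. cmod (C 0 \<omega>) powr t)))
        - 2 * ext_expectation M (\<lambda>\<omega>. ln (cmod (C 0 \<omega>))))"
proof (cases "E = {}")
  \<comment> \<open>Here \<open>d = 0\<close> and both sides vanish, since \<open>1 / 0 = 0\<close> and \<open>0 * \<infinity> = 0\<close>.\<close>
  case True
  then show ?thesis
    using assms(10) by (simp add: zero_ennreal.rep_eq zero_ereal_def[symmetric])
next
  case False
  interpret prob_space M by fact
  have d: "d > 0"
    using False assms(8-10) setdist_eq_0_compact_closed[of E "sphere 0 1"]
      setdist_pos_le[of E "sphere 0 1"] by (auto simp: less_le)
  have meas [measurable]: "C k \<in> borel_measurable M" for k
    using assms(2) by (auto simp: indep_vars_def)
  have nz: "AE \<omega> in M. C k \<omega> \<noteq> 0" for k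
    using AE_nonzero_of_distributed_lborel[OF _ meas assms(3)] assms(4) by blast
  define \<mu> where "\<mu> = expectation (\<lambda>\<omega>. cmod (C 0 \<omega>) powr t)"
  have moment: "integrable M (\<lambda>\<omega>. cmod (C k \<omega>) powr t)"
    "expectation (\<lambda>\<omega>. cmod (C k \<omega>) powr t) = \<mu>" for k
    using integral_comp_eq_of_distr_eq[OF meas meas assms(3)[of k], of "\<lambda>x. cmod x powr t"] assms(6)
    unfolding \<mu>_def by auto
  have \<mu>: "\<mu> > 0"
  proof -
    have "\<mu> \<noteq> 0"
    proof
      assume "\<mu> = 0"
      then have "AE \<omega> in M. cmod (C 0 \<omega>) powr t = 0"
        using integral_nonneg_eq_0_iff_AE[OF assms(6)] by (simp add: \<mu>_def)
      with nz[of 0] have "AE \<omega> in M. False"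
        by eventually_elim simp
      then show False
        by simp
    qed
    moreover have "\<mu> \<ge> 0"
      unfolding \<mu>_def by (rule integral_nonneg_AE) auto
    ultimately show ?thesis
      by simp
  qed
  show ?thesis
  proof (cases "integrable M (\<lambda>\<omega>. ln (cmod (C 0 \<omega>)))")
    \<comment> \<open>The right-hand side is infinite, as \<open>(d + 1) / d\<close> is positive.\<close>
    case False
    then have "ext_expectation M (\<lambda>\<omega>. ln (cmod (C 0 \<omega>))) = -\<infinity>"
      using integrable_ln_cmod_or_ext_expectation_eq_MInf[OF meas assms(5,6)] by blast
    then show ?thesis
      using d by simp
  next
    case int0: True
    define L where "L = expectation (\<lambda>\<omega>. ln (cmod (C 0 \<omega>)))"
    have lnC: "integrable M (\<lambda>\<omega>. ln (cmod (C k \<omega>)))" "expectation (\<lambda>\<omega>. ln (cmod (C k \<omega>))) = L" for k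
      using integral_comp_eq_of_distr_eq[OF meas meas assms(3)[of k], of "\<lambda>x. ln (cmod x)"] int0
      by (auto simp: L_def)
    \<comment> \<open>\<open>m\<close> is the expectation of the sum of the \<open>cmod (C k \<omega>) powr t\<close>, where the tangent is taken.\<close>
    define m where "m = (real n + 1) * \<mu>"
    have m: "m > 0"
      using \<mu> by (simp add: m_def)
    define G where "G = (\<lambda>\<omega>. (d + 1) / d *
      (ln (real n + 1) + 2 / t * ((\<Sum>k\<le>n. cmod (C k \<omega>) powr t) / m - 1 + ln m)
        - ln (cmod (C 0 \<omega>)) - ln (cmod (C n \<omega>))))"
    have G_int: "integrable M G"
      unfolding G_def using moment lnC by auto
    have "(\<integral>\<omega>. (\<Sum>k\<le>n. cmod (C k \<omega>) powr t) \<partial>M) = m"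
      by (simp add: moment m_def)
    then have "expectation G = (d + 1) / d * (ln (real n + 1) + 2 / t * (m / m - 1 + ln m) - L - L)"
      unfolding G_def by (simp add: moment(1) lnC prob_space del: Bochner_Integration.integral_sum)
    also have "\<dots> = (d + 1) / d * (ln (real n + 1) + 2 / t * ln m - 2 * L)"
      using m by simp
    also have "\<dots> = (d + 1) / d * ((t + 2) / t * ln (real n + 1) + 2 / t * ln \<mu> - 2 * L)"
    proof -
      have "ln m = ln (real n + 1) + ln \<mu>" "(t + 2) / t = 1 + 2 / t"
        using \<mu> assms(5) by (simp_all add: m_def ln_mult_pos add_divide_distrib)
      then show ?thesis
        by (simp only: ring_distribs mult_1_left add.assoc)
    qed
    finally have G_eq: "expectation G =
      (d + 1) / d * ((t + 2) / t * ln (real n + 1) + 2 / t * ln \<mu> - 2 * L)" .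
    have bound: "AE \<omega> in M. real (size (filter_mset (\<lambda>z. z \<in> E) (proots (random_poly C n \<omega>)))) \<le> G \<omega>"
      using nz[of 0] nz[of n]
    proof eventually_elim
      case (elim \<omega>)
      let ?p = "random_poly C n \<omega>"
      have sq: "coeff_sq_sum ?p = (\<Sum>k\<le>n. (cmod (C k \<omega>))\<^sup>2)"
        unfolding coeff_sq_sum_def degree_random_poly[of C n \<omega>, OF elim(2)]
        by (intro sum.cong) (auto simp: coeff_random_poly)
      have "real (size (filter_mset (\<lambda>z. z \<in> E) (proots ?p))) \<le> (d + 1) / d *
        (ln (\<Sum>k\<le>n. (cmod (C k \<omega>))\<^sup>2) - ln (cmod (C 0 \<omega>)) - ln (cmod (C n \<omega>)))"
        using count_roots_le[OF _ assms(10) d, of ?p] elim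
        by (simp add: sq coeff_random_poly degree_random_poly)
      also have "\<dots> \<le> G \<omega>"
        unfolding G_def using d ln_sum_squares_le[of "\<lambda>k. C k \<omega>", OF elim(1) assms(5) m, of n]
        by (intro mult_left_mono diff_right_mono) auto
      finally show ?case .
    qed
    have "(\<integral>\<^sup>+\<omega>. of_nat n * emeasure (zero_counting_measure n (random_poly C n \<omega>)) E \<partial>M)
      \<le> (\<integral>\<^sup>+\<omega>. ennreal (G \<omega>) \<partial>M)"
    proof (rule nn_integral_mono_AE)
      show "AE \<omega> in M. of_nat n * emeasure (zero_counting_measure n (random_poly C n \<omega>)) E
          \<le> ennreal (G \<omega>)"
        using bound
      proof eventually_elim
        case (elim \<omega>)
        then show ?case
          unfolding emeasure_zero_counting_measure[OF assms(7)]
          by (simp only: ennreal_of_nat_eq_real_of_nat ennreal_leI)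
      qed
    qed
    also have "\<dots> = ennreal (expectation G)"
      by (rule nn_integral_eq_integral[OF G_int]) (use bound in \<open>auto elim: eventually_mono\<close>)
    finally have "enn2ereal (\<integral>\<^sup>+\<omega>. of_nat n * emeasure (zero_counting_measure n (random_poly C n \<omega>)) E \<partial>M)
      \<le> enn2ereal (ennreal (expectation G))"
      by (simp add: less_eq_ennreal.rep_eq)
    also have "\<dots> = ereal (expectation G)"
      by (intro enn2ereal_ennreal integral_nonneg_AE) (use bound in \<open>auto elim: eventually_mono\<close>)
    also have "\<dots> = ereal ((d + 1) / d) *
      (ereal ((t + 2) / t * ln (real n + 1) + 2 / t * ln \<mu>)
        - 2 * ext_expectation M (\<lambda>\<omega>. ln (cmod (C 0 \<omega>))))"
      unfolding ext_expectation_integrable[OF int0] G_eq L_def[symmetric]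
      by (simp add: numeral_eq_ereal)
    finally show ?thesis
      unfolding \<mu>_def .
  qed
qed

end
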